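(* Let $(X,\|\cdot\|)$ be a normed linear space with induced metric $d(x,y)=\|x-y\|$, and let $C\subseteq X$ be an externally convex subset of $(X,d)$. Then $C$ is sleek in the subspace topology. In particular, every normed linear space is sleek.
   Context: For a metric space $(Y,d)$, $y\in Y$ and $r>0$, write $B_d(y,r)=\{z\in Y: d(y,z)<r\}$ and $B_d[y,r]=\{z\in Y: d(y,z)\le r\}$. The metric $d$ is a sleek metric for $Y$ if the interior of $B_d[y,r]$ in $Y$ equals $B_d(y,r)$ for all $y\in Y$ and $r>0$. A metrizable space is sleek if its topology is induced by a sleek metric. A metric space $(Y,d)$ is externally convex if for every pair of distinct points $x,y\in Y$ there exists $z\in Y\setminus\{x,y\}$ with $d(x,y)+d(y,z)=d(x,z)$. A subset $C$ of a metric space $(X,d)$ is an externally convex set if $(C,d)$ is an externally convex metric space and, for every pair of distinct points $x,y\in C$, any $z\in X$ satisfying $d(x,y)+d(y,z)=d(x,z)$ belongs to $C$. *)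

theory Defs
  imports "HOL-Analysis.Analysis"
begin

definition sleek_metric :: "'a set \<Rightarrow> ('a \<Rightarrow> 'a \<Rightarrow> real) \<Rightarrow> bool" where
  "sleek_metric Y d \<longleftrightarrow>
     Metric_space Y d \<and>
     (\<forall>y\<in>Y. \<forall>r>0.
        Metric_space.mtopology Y d interior_of (Metric_space.mcball Y d y r) =
          Metric_space.mball Y d y r)"

text \<open>Metrizability of the space is implied by the existence of the metric.\<close>

definition sleek_space :: "'a topology \<Rightarrow> bool" where
  "sleek_space T \<longleftrightarrow>
     (\<exists>d. sleek_metric (topspace T) d \<and> Metric_space.mtopology (topspace T) d = T)"

definition externally_convex_metric :: "'a set \<Rightarrow> ('a \<Rightarrow> 'a \<Rightarrow> real) \<Rightarrow> bool" where
  "externally_convex_metric Y d \<longleftrightarrow>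
     Metric_space Y d \<and>
     (\<forall>x\<in>Y. \<forall>y\<in>Y. x \<noteq> y \<longrightarrow> (\<exists>z\<in>Y - {x, y}. d x y + d y z = d x z))"

definition externally_convex_set :: "'a set \<Rightarrow> ('a \<Rightarrow> 'a \<Rightarrow> real) \<Rightarrow> 'a set \<Rightarrow> bool" where
  "externally_convex_set X d C \<longleftrightarrow>
     Metric_space X d \<and> C \<subseteq> X \<and> externally_convex_metric C d \<and>
     (\<forall>x\<in>C. \<forall>y\<in>C. x \<noteq> y \<longrightarrow> (\<forall>z\<in>X. d x y + d y z = d x z \<longrightarrow> z \<in> C))"

end

theory Submission
  imports Defs
begin

text \<open>
  The norm metric itself is sleek on every externally convex set. The only way for a metric to fail
  to be sleek is that some closed ball contains a neighbourhood of a point \<open>x\<close> on its bounding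
  sphere. In a normed space \<open>x\<close> can be pushed away from the centre \<open>y\<close> along the ray from \<open>y\<close>
  through \<open>x\<close>: the points \<open>x + t (x - y)\<close> with \<open>t > 0\<close> small are arbitrarily close to \<open>x\<close>, they lie
  outside the ball, and since \<open>x\<close> is metrically between \<open>y\<close> and them, external convexity of the set
  puts them into the set. The whole space is the special case of the full set, where the condition
  reduces to the prolongability of segments.
\<close>

text \<open>
  A point of the interior of a closed ball that is not in the open ball would be a local maximum
  of the distance from the centre; so it suffices that this distance has no local maximum
  other than possibly at the centre itself.
\<close>

lemma sleek_metric_if_no_local_max:
  assumes "Metric_space Y d"
    and escape: "\<And>y x e. \<lbrakk>y \<in> Y; x \<in> Y; x \<noteq> y; e > 0\<rbrakk> \<Longrightarrow> \<exists>z\<in>Y. d x z < e \<and> d y x < d y z"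
  shows "sleek_metric Y d"
proof -
  interpret Metric_space Y d by fact
  have "mtopology interior_of mcball y r = mball y r" if y: "y \<in> Y" and r: "r > 0" for y r
  proof
    show "mball y r \<subseteq> mtopology interior_of mcball y r"
      by (simp add: interior_of_maximal mball_subset_mcball)
    show "mtopology interior_of mcball y r \<subseteq> mball y r"
    proof
      fix x assume x: "x \<in> mtopology interior_of mcball y r"
      have "openin mtopology (mtopology interior_of mcball y r)"
        by simp
      then obtain e where "e > 0" and "mball x e \<subseteq> mtopology interior_of mcball y r"
        using x unfolding openin_mtopology by blast
      then have ball: "mball x e \<subseteq> mcball y r"
        using interior_of_subset[of mtopology "mcball y r"] by blast
      have xr: "x \<in> Y" "d y x \<le> r"
        using x interior_of_subset[of mtopology "mcball y r"] by auto
      have "d y x \<noteq> r"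
      proof
        assume eq: "d y x = r"
        then have "x \<noteq> y" using r y by auto
        then obtain z where "z \<in> Y" "d x z < e" "d y x < d y z"
          using escape y xr \<open>e > 0\<close> by blast
        moreover from this have "z \<in> mball x e" using xr by simp
        with ball have "z \<in> mcball y r" by blast
        ultimately show False using eq by simp
      qed
      then show "x \<in> mball y r" using xr y by simp
    qed
  qed
  then show ?thesis
    unfolding sleek_metric_def using assms(1) by blast
qed

lemma Metric_space_norm: "Metric_space C (\<lambda>x y. norm (x - y :: 'a::real_normed_vector))"
  unfolding dist_norm[symmetric]
  by unfold_locales (simp_all add: dist_commute dist_triangle)

lemma mtopology_norm_eq_top_of_set:
  "Metric_space.mtopology C (\<lambda>x y. norm (x - y :: 'a::real_normed_vector)) = top_of_set C"
proof -
  interpret Submetric UNIV "dist :: 'a \<Rightarrow> 'a \<Rightarrow> real" C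
    by unfold_locales auto
  have "(\<lambda>x y. norm (x - y :: 'a)) = dist"
    by (simp add: fun_eq_iff dist_norm)
  then show ?thesis
    using mtopology_submetric by simp
qed

lemma sleek_metric_norm_on_externally_convex:
  fixes C :: "'a::real_normed_vector set"
  assumes C: "externally_convex_set UNIV (\<lambda>x y. norm (x - y)) C"
  shows "sleek_metric C (\<lambda>x y. norm (x - y))"
proof (rule sleek_metric_if_no_local_max[OF Metric_space_norm])
  fix y x :: 'a and e :: real
  assume yx: "y \<in> C" "x \<in> C" "x \<noteq> y" and "e > 0"
  define n where "n = norm (x - y)"
  have "n > 0" using yx by (simp add: n_def)
  have nyx: "norm (y - x) = n" by (simp add: n_def norm_minus_commute)
  \<comment> \<open>With this factor, \<open>z\<close> lies at distance \<open>e / 2\<close> beyond \<open>x\<close>.\<close>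
  define t where "t = e / (2 * n)"
  have "t > 0" using \<open>e > 0\<close> \<open>n > 0\<close> by (simp add: t_def)
  define z where "z = x + t *\<^sub>R (x - y)"
  have xz: "norm (x - z) = t * n"
    using \<open>t > 0\<close> by (simp add: z_def n_def)
  have "y - z = - ((1 + t) *\<^sub>R (x - y))"
    by (simp add: z_def algebra_simps)
  then have yz: "norm (y - z) = (1 + t) * n"
    using \<open>t > 0\<close> unfolding n_def by (simp only: norm_minus_cancel norm_scaleR)
  have between: "norm (y - x) + norm (x - z) = norm (y - z)"
    using xz yz nyx by (simp add: distrib_right)
  have "\<forall>y\<in>C. \<forall>x\<in>C. y \<noteq> x \<longrightarrow>
      (\<forall>z\<in>UNIV. norm (y - x) + norm (x - z) = norm (y - z) \<longrightarrow> z \<in> C)"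
    using C unfolding externally_convex_set_def by (elim conjE)
  from this[rule_format, OF yx(1,2) yx(3)[symmetric] UNIV_I between] have "z \<in> C" .
  moreover have "norm (x - z) < e"
    using xz \<open>n > 0\<close> \<open>e > 0\<close> by (simp add: t_def)
  moreover have "norm (y - x) < norm (y - z)"
    using yz nyx \<open>t > 0\<close> \<open>n > 0\<close> by simp
  ultimately show "\<exists>z\<in>C. norm (x - z) < e \<and> norm (y - x) < norm (y - z)"
    by blast
qed

lemma externally_convex_set_UNIV:
  "externally_convex_set UNIV (\<lambda>x y. norm (x - y)) (UNIV :: 'a::real_normed_vector set)"
proof -
  have "\<exists>z\<in>UNIV - {x, y}. norm (x - y) + norm (y - z) = norm (x - z)"
    if "x \<noteq> y" for x y :: 'a
  proof
    \<comment> \<open>The reflection of \<open>x\<close> in \<open>y\<close> prolongs the segment.\<close>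
    let ?z = "y + (y - x)"
    have xz: "x - ?z = 2 *\<^sub>R (x - y)"
      by (simp add: scaleR_2)
    then have "x - ?z \<noteq> 0"
      using that by simp
    then show "?z \<in> UNIV - {x, y}"
      using that by auto
    have "norm (x - ?z) = 2 * norm (x - y)"
      unfolding xz by simp
    moreover have "norm (y - ?z) = norm (x - y)"
      by simp
    ultimately show "norm (x - y) + norm (y - ?z) = norm (x - ?z)"
      by linarith
  qed
  then show ?thesis
    unfolding externally_convex_set_def externally_convex_metric_def
    by (intro conjI ballI impI Metric_space_norm subset_UNIV UNIV_I)
qed

theorem theorem3p6:
  "(\<forall>C :: 'a::real_normed_vector set.
      externally_convex_set UNIV (\<lambda>x y. norm (x - y)) C \<longrightarrow> sleek_space (top_of_set C)) \<and>
   sleek_space (euclidean :: 'a topology)"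
proof -
  have sleek: "sleek_space (top_of_set C)"
    if "externally_convex_set UNIV (\<lambda>x y. norm (x - y)) C" for C :: "'a set"
    unfolding sleek_space_def
    using sleek_metric_norm_on_externally_convex[OF that] mtopology_norm_eq_top_of_set[of C]
    by auto
  moreover have "sleek_space (euclidean :: 'a topology)"
    using sleek[OF externally_convex_set_UNIV] by simp
  ultimately show ?thesis by blast
qed

end
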